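(* Let $A=\{a_1<a_2<\cdots\}$ be an infinite set of positive integers and let $B$ be a set of positive integers such that $A,B$ are exact additive complements. Suppose that $$\frac{a_{n+1}}{n\,a_n}\to\infty \quad\text{as } n\to\infty .$$ Then $$A(x)B(x)-x\ \ge\ \frac{a^*(x)}{A(x)}+o\!\left(\frac{a^*(x)}{A(x)^2}\right)\quad\text{as } x\to+\infty,$$ that is, for every $\varepsilon>0$ there is $x_0$ such that for all $x\ge x_0$, $$A(x)B(x)-x\ \ge\ \frac{a^*(x)}{A(x)}-\varepsilon\,\frac{a^*(x)}{A(x)^2}.$$
   Context: For a set $S$ of positive integers and real $x$, $S(x)=|S\cap[1,x]|$ denotes the counting function of $S$; in particular $A(x)=|A\cap[1,x]|$ and $B(x)=|B\cap[1,x]|$. For $x\ge a_1$, $a^*(x)$ denotes the largest element of $A\cap[1,x]$. The sumset is $A+B=\{a+b: a\in A,\ b\in B\}$. Two sets $A,B$ of positive integers are called additive complements if $A+B$ contains all sufficiently large integers; they are called exact additive complements if, in addition, $A(x)B(x)/x\to 1$ as $x\to\infty$. *)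

theory Defs
  imports Complex_Main "HOL-Library.Infinite_Set" "HOL-Library.Set_Algebras"
begin

definition initial_part :: "nat set \<Rightarrow> real \<Rightarrow> nat set" where
  "initial_part S x = {n \<in> S. 1 \<le> n \<and> real n \<le> x}"

definition counting :: "nat set \<Rightarrow> real \<Rightarrow> real" where
  "counting S x = real (card (initial_part S x))"

text \<open>Meaningful only if \<open>x\<close> is at least the smallest positive element of \<open>S\<close>; otherwise \<open>Max\<close>
  is applied to the empty set.\<close>

definition largest_upto :: "nat set \<Rightarrow> real \<Rightarrow> real" where
  "largest_upto S x = real (Max (initial_part S x))"

text \<open>The \<open>n\<close>-th smallest element for \<open>n = 1, 2, \<dots>\<close>; the library function \<open>enumerate\<close> counts
  from 0. The value at \<open>n = 0\<close> is junk.\<close>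

definition nth_elem :: "nat set \<Rightarrow> nat \<Rightarrow> nat" where
  "nth_elem S n = enumerate S (n - 1)"

text \<open>Here \<open>A + B\<close> is the sumset from \<open>Set_Algebras\<close>.\<close>

definition additive_complements :: "nat set \<Rightarrow> nat set \<Rightarrow> bool" where
  "additive_complements A B \<longleftrightarrow>
     (\<exists>N. \<forall>n\<ge>N. n \<in> A + B)"

definition exact_additive_complements :: "nat set \<Rightarrow> nat set \<Rightarrow> bool" where
  "exact_additive_complements A B \<longleftrightarrow>
     additive_complements A B \<and>
     ((\<lambda>x::real. counting A x * counting B x / x) \<longlongrightarrow> 1) at_top"

end

theory Submission
  imports Defs
begin

text \<open>Fix \<open>m\<close>, let \<open>F = A \<inter> [1, m]\<close>, \<open>k = |F|\<close>, \<open>M = max F\<close> and \<open>D(y) = k B(y) - y\<close>. Then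
  \<open>D(y) = (\<Sum>a\<in>F. B(y) - B(y - a)) + W(y)\<close>, where \<open>W(y)\<close> is the number of representations
  \<open>a + b \<le> y\<close> minus \<open>y\<close>; as \<open>A + B\<close> misses at most \<open>N\<close> integers, \<open>W\<close> is nondecreasing up to an
  error \<open>N\<close>. Let \<open>d(y) = B(y) - B(y - M)\<close>. The terms with \<open>a < M\<close> contribute at most
  \<open>T = (\<Sum>a\<in>F-{M}. a) = o(M/k)\<close>, which is what the growth condition provides. Comparing
  \<open>D(m) - D(m - M) = k d(m) - M\<close> with the decomposition gives
  \<open>(k - 1) d(m) \<ge> M - d(m - M) - T - N\<close>, so that the upper bound
  \<open>d(m - M) \<le> (1 + o(1)) M/k\<close> is amplified to \<open>D(m) \<ge> d(m) - N \<ge> M/k - o(M/k^2)\<close>.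
  For \<open>m < 2M\<close> this upper bound is exactness at \<open>M - 1\<close>. For \<open>m \<ge> 2M\<close> the same comparison one
  step lower gives it, unless \<open>W(m - M) > M/k\<close>, in which case already \<open>D(m) \<ge> W(m) \<ge> M/k - N\<close>.\<close>

section \<open>Counting elements and representations\<close>

definition card_upto :: "nat set \<Rightarrow> nat \<Rightarrow> nat" where
  "card_upto S m = card {b \<in> S. b \<le> m}"

lemma finite_Collect_mem_le [simp]: "finite {b \<in> S. b \<le> (m::nat)}"
  by (rule finite_subset[of _ "{..m}"]) auto

lemma card_upto_mono: "y \<le> z \<Longrightarrow> card_upto S y \<le> card_upto S z"
  unfolding card_upto_def by (intro card_mono) auto

lemma card_upto_0: "0 \<notin> S \<Longrightarrow> card_upto S 0 = 0"
  unfolding card_upto_def by (auto simp: card_eq_0_iff)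

lemma card_upto_le_add: "card_upto S y \<le> card_upto S (y - a) + a"
proof -
  have "{b \<in> S. b \<le> y} \<subseteq> {b \<in> S. b \<le> y - a} \<union> {y - a<..y}" by auto
  then have "card {b \<in> S. b \<le> y} \<le> card ({b \<in> S. b \<le> y - a} \<union> {y - a<..y})"
    by (intro card_mono) auto
  also have "\<dots> \<le> card {b \<in> S. b \<le> y - a} + card {y - a<..y}" by (rule card_Un_le)
  finally show ?thesis unfolding card_upto_def by simp
qed

text \<open>Truncated subtraction is harmless because \<open>0 \<notin> B\<close>.\<close>

lemma card_upto_window:
  assumes "0 \<notin> B" "z \<le> y"
  shows "card_upto B (z - a) + card {b \<in> B. z < a + b \<and> a + b \<le> y} = card_upto B (y - a)"
proof -
  have "{b \<in> B. b \<le> y - a} = {b \<in> B. b \<le> z - a} \<union> {b \<in> B. z < a + b \<and> a + b \<le> y}"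
  proof (intro equalityI subsetI)
    fix b assume "b \<in> {b \<in> B. b \<le> y - a}"
    moreover have "b \<noteq> 0" using calculation assms(1) by (metis mem_Collect_eq)
    ultimately show "b \<in> {b \<in> B. b \<le> z - a} \<union> {b \<in> B. z < a + b \<and> a + b \<le> y}"
      by auto
  qed (use assms in auto)
  moreover have "{b \<in> B. b \<le> z - a} \<inter> {b \<in> B. z < a + b \<and> a + b \<le> y} = {}"
  proof -
    have False if "b \<in> B" "b \<le> z - a" "z < a + b" for b
    proof -
      have "b \<noteq> 0" using that(1) assms(1) by metis
      with that show False by linarith
    qed
    then show ?thesis by blast
  qed
  moreover have "finite {b \<in> B. z < a + b \<and> a + b \<le> y}"
    by (rule finite_subset[of _ "{..y}"]) auto
  ultimately show ?thesis
    unfolding card_upto_def by (simp add: card_Un_disjoint)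
qed

text \<open>Every integer in \<open>{z + N<..y}\<close> has a representation \<open>a + b\<close>,
  while \<open>card_upto_window\<close> turns the difference of the two sums into the number of
  pairs with \<open>z < a + b \<le> y\<close>. This is the near monotonicity of \<open>W\<close>,
  arranged without subtraction of sums in \<open>nat\<close>.\<close>

lemma sum_card_upto_diff_ge:
  assumes B0: "0 \<notin> B" and zy: "z \<le> y" and finF: "finite F"
    and cov: "\<And>n. N \<le> n \<Longrightarrow> n \<le> y \<Longrightarrow> \<exists>a\<in>F. \<exists>b\<in>B. n = a + b"
  shows "y + (\<Sum>a\<in>F. card_upto B (z - a)) \<le> z + N + (\<Sum>a\<in>F. card_upto B (y - a))"
proof -
  define R where "R a = {b \<in> B. z < a + b \<and> a + b \<le> y}" for a
  have finR: "finite (R a)" for a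
    unfolding R_def by (rule finite_subset[of _ "{..y}"]) auto
  have "{z + N<..y} \<subseteq> (\<lambda>(a, b). a + b) ` Sigma F R"
  proof
    fix n assume n: "n \<in> {z + N<..y}"
    then obtain a b where "a \<in> F" "b \<in> B" "n = a + b" using cov[of n] by auto
    with n show "n \<in> (\<lambda>(a, b). a + b) ` Sigma F R" unfolding R_def by force
  qed
  then have "card {z + N<..y} \<le> card (Sigma F R)"
    using finF finR by (intro surj_card_le) auto
  also have "\<dots> = (\<Sum>a\<in>F. card (R a))" using finF finR by (intro card_SigmaI) auto
  finally have le: "y - (z + N) \<le> (\<Sum>a\<in>F. card (R a))" by simp
  have eq: "(\<Sum>a\<in>F. card_upto B (z - a)) + (\<Sum>a\<in>F. card (R a)) = (\<Sum>a\<in>F. card_upto B (y - a))"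
    unfolding R_def sum.distrib[symmetric] by (intro sum.cong refl card_upto_window B0 zy)
  from le eq show ?thesis by linarith
qed

section \<open>The excess at a fixed m\<close>

text \<open>The finite core, free of asymptotics. The witnesses are \<open>d m\<close> for
  \<open>d0\<close> and \<open>d (m - M)\<close> for \<open>d1\<close>; the last two clauses are the
  two ways of controlling \<open>d1\<close>.\<close>

lemma excess_lower_bound:
  fixes m M N k T :: nat and F :: "nat set"
  assumes B0: "0 \<notin> B" and finF: "finite F" and MF: "M \<in> F" and Mm: "M \<le> m"
    and k: "k = card F" and T: "T = (\<Sum>a\<in>F - {M}. a)"
    and cov: "\<And>n. N \<le> n \<Longrightarrow> n \<le> m \<Longrightarrow> \<exists>a\<in>F. \<exists>b\<in>B. n = a + b"
  defines "D \<equiv> real k * card_upto B m - m"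
  obtains d0 d1 :: real where
    "d0 - N \<le> D" "M - d1 - T - N \<le> (real k - 1) * d0"
    "m < 2 * M \<longrightarrow> d1 \<le> card_upto B (M - 1)"
    "2 * M \<le> m \<longrightarrow> M / k - 2 * N \<le> D \<or> (real k - 1) * d1 \<le> real M + real T + M / k + N"
proof -
  define c where "c y = real (card_upto B y)" for y
  define W where "W y = (\<Sum>a\<in>F. c (y - a)) - real y" for y
  define s where "s y = (\<Sum>a\<in>F - {M}. c y - c (y - a))" for y
  define d where "d y = c y - c (y - M)" for y
  have cmono: "c y \<le> c z" if "y \<le> z" for y z
    unfolding c_def using card_upto_mono[OF that] by simp
  have c0: "c 0 = 0" unfolding c_def using card_upto_0[OF B0] by simp
  have cnn: "0 \<le> c y" for y unfolding c_def by simp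
  have Wmono: "W z - N \<le> W y" if "z \<le> y" "y \<le> m" for y z
  proof -
    have cov': "\<exists>a\<in>F. \<exists>b\<in>B. n = a + b" if "N \<le> n" "n \<le> y" for n
      using cov that \<open>y \<le> m\<close> by (meson le_trans)
    have "y + (\<Sum>a\<in>F. card_upto B (z - a)) \<le> z + N + (\<Sum>a\<in>F. card_upto B (y - a))"
      by (rule sum_card_upto_diff_ge[OF B0 that(1) finF cov'])
    then have "real (y + (\<Sum>a\<in>F. card_upto B (z - a))) \<le> real (z + N + (\<Sum>a\<in>F. card_upto B (y - a)))"
      by linarith
    then show ?thesis unfolding W_def c_def by simp
  qed
  \<comment> \<open>Comparison with \<open>z = 0\<close> makes the near monotonicity of
    \<open>W\<close> a lower bound.\<close>
  have "W 0 = 0" unfolding W_def by (simp add: c0)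
  then have Wge: "- real N \<le> W y" if "y \<le> m" for y using Wmono[of 0 y] that by simp
  have decomp: "real k * c y - y = d y + s y + W y" for y
  proof -
    have "d y + s y = (\<Sum>a\<in>F. c y - c (y - a))"
      unfolding d_def s_def using sum.remove[OF finF MF, of "\<lambda>a. c y - c (y - a)"] by simp
    also have "\<dots> = real k * c y - (\<Sum>a\<in>F. c (y - a))"
      by (simp add: sum_subtractf k)
    finally show ?thesis unfolding W_def by simp
  qed
  have s_nn: "0 \<le> s y" for y unfolding s_def by (intro sum_nonneg) (auto intro: cmono)
  have s_le: "s y \<le> T" for y
  proof -
    have "c y - c (y - a) \<le> real a" for a
      using card_upto_le_add[of B y a] unfolding c_def by linarith
    then have "s y \<le> (\<Sum>a\<in>F - {M}. real a)" unfolding s_def by (intro sum_mono)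
    then show ?thesis by (simp add: T)
  qed
  have d_nn: "0 \<le> d y" for y unfolding d_def using cmono[of "y - M" y] by simp
  \<comment> \<open>\<open>D(y) - D(y - M) = k d(y) - M\<close>, decomposed on both sides\<close>
  have step: "(real k - 1) * d y = M + s y - s (y - M) + W y - W (y - M) - d (y - M)"
    if "M \<le> y" for y
  proof -
    have "real (y - M) = real y - M" using that by simp
    with decomp[of y] decomp[of "y - M"] have
      "real k * (c y - c (y - M)) - M = d y + s y + W y - d (y - M) - s (y - M) - W (y - M)"
      by (simp add: algebra_simps)
    then have "real k * d y - M = d y + s y + W y - d (y - M) - s (y - M) - W (y - M)"
      unfolding d_def by simp
    then show ?thesis by (simp add: algebra_simps)
  qed
  have D: "D = d m + s m + W m" unfolding D_def decomp[symmetric] c_def ..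
  show ?thesis
  proof (rule that[of "d m" "d (m - M)"])
    show "d m - N \<le> D" using D s_nn[of m] Wge[of m] by simp
    show "M - d (m - M) - T - N \<le> (real k - 1) * d m"
      using step[OF Mm] s_nn[of m] s_le[of "m - M"] Wmono[of "m - M" m] by simp
    show "m < 2 * M \<longrightarrow> d (m - M) \<le> card_upto B (M - 1)"
    proof
      assume "m < 2 * M"
      then have "c (m - M) \<le> c (M - 1)" by (intro cmono) auto
      then show "d (m - M) \<le> card_upto B (M - 1)"
        unfolding d_def using cnn[of "m - M - M"] unfolding c_def by linarith
    qed
    show "2 * M \<le> m \<longrightarrow> M / k - 2 * N \<le> D \<or> (real k - 1) * d (m - M) \<le> real M + real T + M / k + N"
    proof
      assume 2: "2 * M \<le> m"
      show "M / k - 2 * N \<le> D \<or> (real k - 1) * d (m - M) \<le> real M + real T + M / k + N"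
      proof (cases "M / k \<le> W (m - M)")
        case True
        then show ?thesis using D d_nn[of m] s_nn[of m] Wmono[of "m - M" m] by simp
      next
        case False
        \<comment> \<open>Here \<open>step\<close> is applied at \<open>m - M\<close>, which is
          legitimate as \<open>2 * M \<le> m\<close>: the failed case bounds
          \<open>W (m - M)\<close> above, and \<open>Wge\<close> bounds \<open>W (m - M - M)\<close>
          below.\<close>
        then show ?thesis
          using step[of "m - M"] 2 s_le[of "m - M"] s_nn[of "m - M - M"] Wge[of "m - M - M"]
            d_nn[of "m - M - M"] by simp
      qed
    qed
  qed
qed

section \<open>Real estimates\<close>

text \<open>The bounds below are written in the unit \<open>E = M / k\<^sup>2\<close>.\<close>

lemma excess_asymptotics:
  fixes k E \<eta> d0 d1 D N T C :: real
  assumes \<eta>: "0 < \<eta>" "\<eta> \<le> 1" and k: "3 / \<eta> \<le> k" and E: "0 < E"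
    and N: "0 \<le> N" "N \<le> \<eta> * E" and T: "T \<le> \<eta> * (k * E)"
    and 1: "d0 - N \<le> D" and 2: "k\<^sup>2 * E - d1 - T - N \<le> (k - 1) * d0"
    and 3: "d1 \<le> C \<or> k * E - 2 * N \<le> D \<or> (k - 1) * d1 \<le> k\<^sup>2 * E + T + k * E + N"
    and C: "(k - 1) * C \<le> (1 + \<eta>) * (k\<^sup>2 * E)"
  shows "k * E - 11 * \<eta> * E \<le> D"
proof (cases "k * E - 2 * N \<le> D")
  case True
  have "2 * N \<le> 11 * \<eta> * E" using N \<eta> E by (simp add: algebra_simps)
  then show ?thesis using True by linarith
next
  case False
  have \<eta>k: "3 \<le> \<eta> * k" using k \<eta> by (simp add: field_simps)
  have k3: "3 \<le> k"
  proof -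
    have "\<eta> * k \<le> 1 * k" using \<eta> k by (intro mult_right_mono) (auto intro: order_trans[rotated])
    then show ?thesis using \<eta>k by linarith
  qed
  have kE: "E \<le> k * E" "0 < k * E" using k3 E by auto
  have d1: "(k - 1) * d1 \<le> (1 + \<eta>) * (k\<^sup>2 * E)"
  proof (cases "d1 \<le> C")
    case True
    then have "(k - 1) * d1 \<le> (k - 1) * C" using k3 by (intro mult_left_mono) auto
    then show ?thesis using C by linarith
  next
    case False
    with 3 \<open>\<not> k * E - 2 * N \<le> D\<close> have "(k - 1) * d1 \<le> k\<^sup>2 * E + T + k * E + N" by blast
    \<comment> \<open>\<open>T\<close>, \<open>k * E\<close> and \<open>N\<close> are each at most
      \<open>k * E\<close>, and together at most \<open>3 * (k * E)\<close>; this is where the 3 in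
      \<open>3 / \<eta> \<le> k\<close> is spent.\<close>
    moreover have "\<eta> * (k * E) \<le> 1 * (k * E)" using \<eta> kE by (intro mult_right_mono) auto
    moreover have "\<eta> * E \<le> 1 * E" using \<eta> E by (intro mult_right_mono) auto
    moreover have "3 * (k * E) \<le> \<eta> * (k\<^sup>2 * E)"
      using mult_right_mono[OF \<eta>k, of "k * E"] kE by (simp add: power2_eq_square mult.assoc)
    moreover have "(1 + \<eta>) * (k\<^sup>2 * E) = k\<^sup>2 * E + \<eta> * (k\<^sup>2 * E)" by (simp add: distrib_right)
    ultimately show ?thesis using N T kE by linarith
  qed
  \<comment> \<open>The right side exceeds the left by
    \<open>2 * \<eta> * k - 1 - 3 * \<eta>\<close>, which is at least 6 - 1 - 3.\<close>
  have "(1 + \<eta>) * k \<le> (1 + 3 * \<eta>) * (k - 1)"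
    using \<eta>k \<eta> by (simp add: algebra_simps)
  then have "((1 + \<eta>) * k) * (k * E) \<le> ((1 + 3 * \<eta>) * (k - 1)) * (k * E)"
    using kE by (intro mult_right_mono) auto
  then have "(k - 1) * d1 \<le> (k - 1) * ((1 + 3 * \<eta>) * (k * E))"
    using d1 by (simp add: power2_eq_square algebra_simps)
  then have d1': "d1 \<le> (1 + 3 * \<eta>) * (k * E)" using k3 by simp
  have "N \<le> \<eta> * (k * E)"
    using N mult_left_mono[OF kE(1), of \<eta>] \<eta> by linarith
  \<comment> \<open>The 5 collects 3 from \<open>d1'\<close> and 1 each from \<open>T\<close> and
    \<open>N\<close>.\<close>
  with 2 d1' T have "k\<^sup>2 * E - k * E - 5 * (\<eta> * (k * E)) \<le> (k - 1) * d0"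
    by (simp add: algebra_simps)
  \<comment> \<open>Dividing by \<open>k - 1\<close> instead of \<open>k\<close> is paid for by
    doubling the 5 to 10, since \<open>k \<ge> 2\<close>. The final use of
    \<open>N \<le> \<eta> * E\<close> makes it 11.\<close>
  moreover have "(k - 1) * (k * E - 10 * (\<eta> * E)) \<le> k\<^sup>2 * E - k * E - 5 * (\<eta> * (k * E))"
  proof -
    have "10 * (\<eta> * E) \<le> 5 * (\<eta> * (k * E))"
      using mult_right_mono[of 2 k "\<eta> * E"] k3 \<eta> E by (simp add: algebra_simps)
    then show ?thesis by (simp add: algebra_simps power2_eq_square)
  qed
  ultimately have "(k - 1) * (k * E - 10 * (\<eta> * E)) \<le> (k - 1) * d0" by linarith
  then have "k * E - 10 * (\<eta> * E) \<le> d0" using k3 by simp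
  then show ?thesis using 1 N by linarith
qed

section \<open>Consequences of the growth condition\<close>

text \<open>Passing from \<open>j\<close> to \<open>Suc j\<close> adds \<open>a j\<close> to the
  bound, and \<open>2 * a j\<close> is absorbed by \<open>a (Suc j)\<close>. The terms before
  \<open>p\<close>, where doubling may fail, stay as a constant.\<close>

lemma sum_le_of_doubling:
  fixes a :: "nat \<Rightarrow> real"
  assumes "\<And>j. p \<le> j \<Longrightarrow> 2 * a j \<le> a (Suc j)" "0 \<le> a p" "p \<le> j"
  shows "(\<Sum>i<j. a i) \<le> a j + (\<Sum>i<p. a i)"
  using assms(3)
proof (induction j rule: dec_induct)
  case (step j)
  then show ?case using assms(1)[of j] by simp
qed (use assms in auto)

text \<open>With \<open>k = Suc j\<close> and \<open>M = a j\<close>, the first claim makes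
  constants such as \<open>N\<close> negligible against M/k^2, and the second gives T = o(M/k) for
  the sum \<open>T\<close> of the earlier elements.\<close>

lemma eventually_growth:
  fixes a :: "nat \<Rightarrow> nat"
  assumes mono: "strict_mono a" and pos: "0 < a 0"
    and lim: "filterlim (\<lambda>j. real (a (Suc j)) / (real (Suc j) * real (a j))) at_top sequentially"
    and "0 < (K::real)"
  shows "\<forall>\<^sub>F j in sequentially. K * (real (Suc j))\<^sup>2 \<le> a j"
    and "\<forall>\<^sub>F j in sequentially. K * (\<Sum>i<j. a i) * (real (Suc j)) \<le> a j"
proof -
  have apos: "0 < real (a j)" for j
    using pos strict_mono_less_eq[OF mono, of 0 j] by simp
  have ev: "\<forall>\<^sub>F j in sequentially. L * (real (Suc j) * a j) \<le> a (Suc j)" for L :: real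
    using filterlim_at_top[THEN iffD1, OF lim, rule_format, of L]
    by eventually_elim (simp only: pos_le_divide_eq[OF mult_pos_pos[OF of_nat_0_less_iff[THEN iffD2,
      OF zero_less_Suc] apos]])
  \<comment> \<open>The growth condition bounds \<open>a (Suc j)\<close>, so the claim is proved at
    \<open>Suc j\<close> and shifted back. The 4 comes from squaring
    \<open>Suc (Suc j) \<le> 2 * Suc j\<close>; one factor \<open>Suc j\<close> is supplied by
    \<open>Suc j \<le> a j\<close>.\<close>
  have "\<forall>\<^sub>F j in sequentially. K * (real (Suc (Suc j)))\<^sup>2 \<le> a (Suc j)"
    using ev[of "4 * K"]
  proof eventually_elim
    case (elim j)
    have "Suc j \<le> a j"
    proof (induction j)
      case (Suc j)
      then show ?case using strict_monoD[OF mono, of j "Suc j"] by simp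
    qed (use pos in simp)
    then have "(4 * K) * (real (Suc j) * real (Suc j)) \<le> (4 * K) * (real (Suc j) * a j)"
      using \<open>0 < K\<close> by (intro mult_left_mono) auto
    moreover have "K * (real (Suc (Suc j)))\<^sup>2 \<le> K * (2 * real (Suc j))\<^sup>2"
      using \<open>0 < K\<close> by (intro mult_left_mono power_mono) auto
    moreover have "K * (2 * real (Suc j))\<^sup>2 = (4 * K) * (real (Suc j) * real (Suc j))"
      by (simp add: power2_eq_square del: of_nat_Suc)
    ultimately show ?case using elim by linarith
  qed
  then show "\<forall>\<^sub>F j in sequentially. K * (real (Suc j))\<^sup>2 \<le> a j"
    by (rule eventually_sequentially_Suc[THEN iffD1])
  from ev[of 2] obtain p where p: "\<And>j. p \<le> j \<Longrightarrow> 2 * (real (Suc j) * a j) \<le> a (Suc j)"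
    unfolding eventually_sequentially by blast
  have dbl: "2 * real (a j) \<le> a (Suc j)" if "p \<le> j" for j
    using p[OF that] mult_right_mono[of 1 "real (Suc j)" "2 * real (a j)"] by simp
  define S where "S = (\<Sum>i<p. real (a i))"
  have S0: "0 \<le> S" unfolding S_def by (intro sum_nonneg) auto
  \<comment> \<open>As \<open>1 \<le> a j\<close>, the sum is at most
    \<open>2 * a j + S \<le> (2 + S) * a j\<close>; the other factor 2 again replaces
    \<open>Suc (Suc j)\<close> by \<open>Suc j\<close>.\<close>
  have "\<forall>\<^sub>F j in sequentially. K * (\<Sum>i<Suc j. a i) * real (Suc (Suc j)) \<le> a (Suc j)"
    using ev[of "2 * K * (2 + S)"] eventually_ge_at_top[of p]
  proof eventually_elim
    case (elim j)
    have "1 \<le> real (a j)" using apos[of j] by simp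
    then have "S * 1 \<le> S * a j" using S0 by (intro mult_left_mono)
    then have "(\<Sum>i<Suc j. real (a i)) \<le> (2 + S) * a j"
      using sum_le_of_doubling[of p "\<lambda>j. real (a j)" j, OF dbl] elim(2)
      unfolding S_def by (simp add: algebra_simps)
    then have "K * (\<Sum>i<Suc j. real (a i)) * real (Suc (Suc j))
        \<le> K * ((2 + S) * a j) * (2 * real (Suc j))"
      using \<open>0 < K\<close> S0 by (intro mult_mono mult_left_mono) (auto intro!: sum_nonneg mult_nonneg_nonneg)
    also have "\<dots> \<le> a (Suc j)" using elim(1) by (simp add: algebra_simps)
    finally show ?case by simp
  qed
  then show "\<forall>\<^sub>F j in sequentially. K * (\<Sum>i<j. a i) * (real (Suc j)) \<le> a j"
    by (rule eventually_sequentially_Suc[THEN iffD1])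
qed

section \<open>From integers to real x, and the final estimate\<close>

lemma counting_of_nat: "0 \<notin> S \<Longrightarrow> counting S (real m) = card_upto S m"
  unfolding counting_def initial_part_def card_upto_def
  by (auto intro!: arg_cong[where f = card] simp: Suc_le_eq intro: gr0I)

lemma initial_part_floor:
  "0 \<le> x \<Longrightarrow> initial_part S x = initial_part S (real (nat \<lfloor>x\<rfloor>))"
proof -
  assume "0 \<le> x"
  then have "real n \<le> x \<longleftrightarrow> n \<le> nat \<lfloor>x\<rfloor>" for n by (simp add: le_nat_iff le_floor_iff)
  then show ?thesis unfolding initial_part_def by simp
qed

theorem theorem1p1:
  fixes A B :: "nat set"
  assumes "infinite A"
    and "0 \<notin> A" and "0 \<notin> B"
    and "exact_additive_complements A B"
    and "filterlim (\<lambda>n. real (nth_elem A (n + 1)) / (real n * real (nth_elem A n)))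
           at_top sequentially"
  shows "\<forall>\<epsilon>::real. \<epsilon> > 0 \<longrightarrow> (\<exists>x\<^sub>0::real. \<forall>x\<ge>x\<^sub>0.
           counting A x * counting B x - x
             \<ge> largest_upto A x / counting A x - \<epsilon> * (largest_upto A x / (counting A x)\<^sup>2))"
proof (intro allI impI)
  fix \<epsilon> :: real assume "\<epsilon> > 0"
  \<comment> \<open>The 12 is the 11 of \<open>excess_asymptotics\<close> plus 1 for rounding
    \<open>x\<close> down to an integer.\<close>
  define \<eta> where "\<eta> = min 1 (\<epsilon> / 12)"
  have \<eta>: "0 < \<eta>" "\<eta> \<le> 1" "12 * \<eta> \<le> \<epsilon>" using \<open>\<epsilon> > 0\<close> unfolding \<eta>_def by auto
  define a where "a = enumerate A"
  have mono: "strict_mono a" unfolding a_def using strict_mono_enumerate[OF \<open>infinite A\<close>] .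
  have range_a: "range a = A" unfolding a_def using range_enumerate[OF \<open>infinite A\<close>] .
  have apos: "0 < a j" for j using range_a \<open>0 \<notin> A\<close> by (metis gr0I rangeI)
  \<comment> \<open>Composition with \<open>Suc\<close> passes to indices from 0 and skips the junk
    value \<open>nth_elem A 0\<close>.\<close>
  have lim: "filterlim (\<lambda>j. real (a (Suc j)) / (real (Suc j) * real (a j))) at_top sequentially"
    using filterlim_compose[OF assms(5) filterlim_Suc] unfolding nth_elem_def a_def by simp
  obtain N where N: "\<And>n. N \<le> n \<Longrightarrow> n \<in> A + B"
    using assms(4) unfolding exact_additive_complements_def additive_complements_def by blast
  have "((\<lambda>x::real. counting A x * counting B x / x) \<longlongrightarrow> 1) at_top"
    using assms(4) unfolding exact_additive_complements_def by blast
  then have "\<forall>\<^sub>F x::real in at_top. counting A x * counting B x / x < 1 + \<eta>"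
    using \<eta> by (intro order_tendstoD) auto
  then have "\<forall>\<^sub>F n in sequentially. counting A (real n) * counting B (real n) / real n < 1 + \<eta>"
    by (rule eventually_compose_filterlim[OF _ filterlim_real_sequentially])
  moreover have "filterlim (\<lambda>j. a j - 1) at_top sequentially"
    using filterlim_compose[OF filterlim_minus_const_nat_at_top filterlim_subseq[OF mono]] .
  ultimately have "\<forall>\<^sub>F j in sequentially. counting A (real (a j - 1)) * counting B (real (a j - 1))
      / real (a j - 1) < 1 + \<eta>"
    by (rule eventually_compose_filterlim)
  \<comment> \<open>\<open>N + 1\<close> rather than \<open>N\<close>: the extra 1 covers the
    difference between \<open>x\<close> and its integer part.\<close>
  moreover note eventually_growth(1)[OF mono apos lim, of "(real N + 1) / \<eta>"]
  moreover note eventually_growth(2)[OF mono apos lim, of "1 / \<eta>"]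
  moreover have "\<forall>\<^sub>F j in sequentially. 3 / \<eta> \<le> real j"
    using filterlim_real_sequentially unfolding filterlim_at_top by blast
  ultimately have "\<forall>\<^sub>F j in sequentially.
      counting A (real (a j - 1)) * counting B (real (a j - 1)) / real (a j - 1) < 1 + \<eta> \<and>
      (real N + 1) / \<eta> * (real (Suc j))\<^sup>2 \<le> a j \<and>
      1 / \<eta> * (\<Sum>i<j. a i) * (real (Suc j)) \<le> a j \<and> 3 / \<eta> \<le> real j"
    using \<eta> by (auto simp: eventually_conj_iff)
  then obtain j0 where j0: "\<And>j. j0 \<le> j \<Longrightarrow>
      counting A (real (a j - 1)) * counting B (real (a j - 1)) / real (a j - 1) < 1 + \<eta> \<and>
      (real N + 1) / \<eta> * (real (Suc j))\<^sup>2 \<le> a j \<and>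
      1 / \<eta> * (\<Sum>i<j. a i) * (real (Suc j)) \<le> a j \<and> 3 / \<eta> \<le> real j"
    unfolding eventually_sequentially by blast
  have main: "counting A x * counting B x - x
      \<ge> largest_upto A x / counting A x - \<epsilon> * (largest_upto A x / (counting A x)\<^sup>2)"
    if x: "real (a j0) \<le> x" for x
  proof -
    define m where "m = nat \<lfloor>x\<rfloor>"
    have x0: "0 \<le> x" using x by linarith
    have xm: "x \<le> real m + 1" unfolding m_def using x0 by linarith
    have j0m: "a j0 \<le> m" unfolding m_def using x by (simp add: le_nat_iff le_floor_iff)
    have bdd: "\<forall>j. a j \<le> m \<longrightarrow> j \<le> m"
      using strict_mono_imp_increasing[OF mono] by (meson le_trans)
    \<comment> \<open>The index from 0 of the largest element of \<open>A\<close> up to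
      \<open>x\<close>, so that \<open>counting A x\<close> is \<open>Suc j\<close>.\<close>
    define j where "j = (GREATEST j. a j \<le> m)"
    have jm: "a j \<le> m"
      unfolding j_def by (rule GreatestI_nat[where P = "\<lambda>j. a j \<le> m", OF j0m]) (use bdd in auto)
    have jmax: "i \<le> j" if "a i \<le> m" for i
      unfolding j_def by (rule Greatest_le_nat[where P = "\<lambda>j. a j \<le> m", OF that]) (use bdd in auto)
    have upto_eq: "{b \<in> A. b \<le> m} = a ` {..j}"
    proof (intro equalityI subsetI)
      fix b assume "b \<in> {b \<in> A. b \<le> m}"
      then obtain i where "b = a i" "a i \<le> m" using range_a by blast
      with jmax show "b \<in> a ` {..j}" by auto
    next
      fix b assume "b \<in> a ` {..j}"
      then obtain i where "i \<le> j" "b = a i" by auto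
      with jm have "b \<le> m" using strict_mono_less_eq[OF mono, of i j] by linarith
      with \<open>b = a i\<close> show "b \<in> {b \<in> A. b \<le> m}" using range_a by auto
    qed
    define F where "F = a ` {..j}"
    have inj: "inj_on a S" for S using mono by (simp add: strict_mono_imp_inj_on inj_on_subset)
    have cardF: "card F = Suc j" unfolding F_def by (simp add: card_image[OF inj])
    have "F - {a j} = a ` {..<j}"
      unfolding F_def using inj_on_image_set_diff[OF inj[of "{..j}"], of "{..j}" "{j}"]
      by (auto simp: strict_mono_eq[OF mono])
    then have T: "(\<Sum>i<j. a i) = (\<Sum>a\<in>F - {a j}. a)" by (simp add: sum.reindex[OF inj])
    have initA: "initial_part A x = F"
    proof -
      have "initial_part A x = {b \<in> A. b \<le> m}"
        unfolding initial_part_floor[OF x0] m_def[symmetric] using \<open>0 \<notin> A\<close>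
        unfolding initial_part_def by (auto simp: Suc_le_eq intro: gr0I)
      then show ?thesis unfolding upto_eq F_def .
    qed
    have cA: "counting A x = Suc j" unfolding counting_def initA cardF ..
    have cB: "counting B x = card_upto B m"
      unfolding counting_of_nat[OF \<open>0 \<notin> B\<close>, symmetric]
      unfolding counting_def initial_part_floor[OF x0] m_def ..
    have "Max F = a j" unfolding F_def
      by (rule Max_eqI) (auto simp: strict_mono_less_eq[OF mono])
    then have la: "largest_upto A x = a j" unfolding largest_upto_def initA by simp
    have cov: "\<exists>a\<in>F. \<exists>b\<in>B. n = a + b" if n: "N \<le> n" "n \<le> m" for n
    proof -
      from N[OF n(1)] obtain a' b where ab: "a' \<in> A" "b \<in> B" "n = a' + b"
        by (auto elim: set_plus_elim)
      then have "a' \<in> F" unfolding F_def upto_eq[symmetric] using n by auto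
      with ab show ?thesis by blast
    qed
    define k where "k = real (Suc j)"
    define E where "E = a j / k\<^sup>2"
    have kpos: "0 < k" unfolding k_def by simp
    have E: "0 < E" unfolding E_def using apos kpos by simp
    have M1: "real (a j) = k\<^sup>2 * E" and M2: "a j / k = k * E"
      unfolding E_def using kpos by (auto simp: power2_eq_square)
    have "j0 \<le> j" using jmax[OF j0m] .
    note ev = j0[OF this]
    have NE: "real N + 1 \<le> \<eta> * E"
      using ev kpos \<eta> unfolding E_def k_def[symmetric] by (simp add: field_simps)
    have TE: "real (\<Sum>i<j. a i) \<le> \<eta> * (k * E)"
      using ev kpos \<eta> unfolding M2[symmetric] k_def[symmetric] by (simp add: field_simps)
    have k3: "3 / \<eta> \<le> k" using ev unfolding k_def by simp
    have C: "(k - 1) * real (card_upto B (a j - 1)) \<le> (1 + \<eta>) * (k\<^sup>2 * E)"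
    proof -
      have "{b \<in> A. b \<le> a j - 1} = a ` {..<j}"
      proof -
        have "b \<le> a j - 1 \<longleftrightarrow> b < a j" for b using apos[of j] by linarith
        then show ?thesis using range_a strict_mono_less[OF mono] by auto
      qed
      then have "counting A (real (a j - 1)) = k - 1"
        unfolding counting_of_nat[OF \<open>0 \<notin> A\<close>] card_upto_def k_def
        by (simp add: card_image[OF inj])
      then have "(k - 1) * real (card_upto B (a j - 1)) / real (a j - 1) \<le> 1 + \<eta>"
        using ev unfolding counting_of_nat[OF \<open>0 \<notin> B\<close>] by simp
      \<comment> \<open>For \<open>a j = 1\<close> the quotient is a division by zero and carries no
        information, so this case is settled by \<open>0 \<notin> B\<close>.\<close>
      moreover have "card_upto B (a j - 1) = 0" if "a j - 1 = 0"
        using card_upto_0[OF \<open>0 \<notin> B\<close>] that by simp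
      ultimately have "(k - 1) * real (card_upto B (a j - 1)) \<le> (1 + \<eta>) * real (a j - 1)"
        by (cases "a j - 1 = 0") (auto simp: field_simps)
      also have "\<dots> \<le> (1 + \<eta>) * real (a j)" using \<eta> by (intro mult_left_mono) auto
      finally show ?thesis unfolding M1 .
    qed
    have finF: "finite F" and "a j \<in> F" unfolding F_def by simp_all
    obtain d0 d1 :: real where d:
      "d0 - N \<le> k * card_upto B m - m" "a j - d1 - real (\<Sum>i<j. a i) - N \<le> (k - 1) * d0"
      "m < 2 * a j \<longrightarrow> d1 \<le> card_upto B (a j - 1)"
      "2 * a j \<le> m \<longrightarrow> a j / k - 2 * N \<le> k * card_upto B m - m \<or>
        (k - 1) * d1 \<le> a j + real (\<Sum>i<j. a i) + a j / k + N"
      unfolding k_def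
      by (rule excess_lower_bound[OF \<open>0 \<notin> B\<close> finF \<open>a j \<in> F\<close> jm cardF[symmetric] T cov])
    have "k * E - 11 * \<eta> * E \<le> k * card_upto B m - m"
    proof (rule excess_asymptotics[OF \<eta>(1,2) k3 E _ _ TE d(1) _ _ C])
      show "real N \<le> \<eta> * E" using NE by simp
      show "k\<^sup>2 * E - d1 - real (\<Sum>i<j. a i) - N \<le> (k - 1) * d0" using d(2) unfolding M1 .
      show "d1 \<le> real (card_upto B (a j - 1)) \<or> k * E - 2 * real N \<le> k * card_upto B m - m \<or>
          (k - 1) * d1 \<le> k\<^sup>2 * E + real (\<Sum>i<j. a i) + k * E + N"
        using d(3,4) unfolding M1 M2[unfolded M1] by linarith
    qed simp
    moreover have "12 * \<eta> * E \<le> \<epsilon> * E" using \<eta> E by (intro mult_right_mono) auto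
    \<comment> \<open>Replacing \<open>m\<close> by \<open>x\<close> loses at most 1, and
      \<open>1 \<le> \<eta> * E\<close> by \<open>NE\<close>.\<close>
    ultimately have "k * E - \<epsilon> * E \<le> k * card_upto B m - x"
      using NE xm by (simp add: algebra_simps)
    then show ?thesis unfolding cA cB la k_def[symmetric] M2 E_def[symmetric] by simp
  qed
  then show "\<exists>x\<^sub>0::real. \<forall>x\<ge>x\<^sub>0. counting A x * counting B x - x
      \<ge> largest_upto A x / counting A x - \<epsilon> * (largest_upto A x / (counting A x)\<^sup>2)"
    by blast
qed

end
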